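(* For the general Christoffel transformation $\hat{\vec w}$ of $\vec w=(w_1,w_2)$ by the polynomial $\tilde P(x)=p(x^2)P(x)$ of degree $\tilde N=2M+N$, for $n\ge\tilde N$ and $a\in\{1,2\}$, the perturbed type I and type II multiple orthogonal polynomials are given by $$\hat A_a^{(n)}(y)=\frac{1}{\tau_{n+1}\,\pi(y)\,p(y)}\begin{vmatrix}R_n&v_a^{(n)}(y)\\ \vdots&\vdots\\ R_{n+\tilde N}&v_a^{(n+\tilde N)}(y)\end{vmatrix},\qquad \hat B^{(n-1)}(x)=\frac1{\tau_{n-1}}\begin{vmatrix}\mathbf k^{(n)}(x)\\ R_n\\ \vdots\\ R_{n+\tilde N-2}\end{vmatrix},$$ where $$R_l=\big(v_1^{(l)}(r_1^2),\dots,v_1^{(l)}(r_M^2),\,v_2^{(l)}(r_1^2),\dots,v_2^{(l)}(r_M^2),\,v_2^{(l)}(x_1^2),\dots,v_2^{(l)}(x_N^2)\big),$$ $$\mathbf k^{(n)}(x)=\big(k_1^{(n)}(x,r_1^2),\dots,k_1^{(n)}(x,r_M^2),\,k_2^{(n)}(x,r_1^2),\dots,k_2^{(n)}(x,r_M^2),\,k_2^{(n)}(x,x_1^2),\dots,k_2^{(n)}(x,x_N^2)\big),$$ and $\tau_n$ is the determinant of the $\tilde N\times\tilde N$ matrix with rows $R_n,R_{n+1},\dots,R_{n+\tilde N-1}$.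
   Context: Let $\Delta\subset\mathbb R$ be an interval, $\mu$ a measure supported on $\Delta$, and $w_1,w_2$ weight functions on $\Delta$ with all moments finite. All vectors and matrices are semi-infinite, indexed by $0,1,2,\dots$. Put $X(x)=(1,x,x^2,\dots)^\top$, $X_1(x)=(1,0,x,0,x^2,0,\dots)^\top$, $X_2(x)=(0,1,0,x,0,x^2,\dots)^\top$. For a pair of weights $\vec u=(u_1,u_2)$, $g_{\vec u}=\int_\Delta X\big(X_1u_1+X_2u_2\big)^\top\mathrm d\mu$. Perturbing polynomial: $P(x)=(x-x_1)\cdots(x-x_N)\in\mathbb R[x]$ is monic and non-symmetric (if $x_0\neq0$ is a root, then $-x_0$ is not), $p(x)=(x-r_1^2)\cdots(x-r_M^2)\in\mathbb R[x]$, $\tilde P(x)=p(x^2)P(x)$, $\tilde N=2M+N$. Write $P(x)=P_{\mathrm e}(x^2)+xP_{\mathrm o}(x^2)$ with polynomials $P_{\mathrm e},P_{\mathrm o}$, and $\pi(x)=P_{\mathrm e}(x)^2-xP_{\mathrm o}(x)^2$, whose zeros are $x_1^2,\dots,x_N^2$. It is assumed that the zeros $r_1^2,\dots,r_M^2,x_1^2,\dots,x_N^2$ of $p\pi$ are pairwise distinct. Perturbed weights: $\hat{\vec w}=(\hat w_1,\hat w_2)$ with $\hat w_1=p(P_{\mathrm e}w_1+P_{\mathrm o}w_2)$, $\hat w_2=p(xP_{\mathrm o}w_1+P_{\mathrm e}w_2)$. It is assumed that both $g_{\vec w}$ and $g_{\hat{\vec w}}$ have Gauss–Borel factorizations $g_{\vec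 w}=S^{-1}H\tilde S^{-\top}$, $g_{\hat{\vec w}}=\hat S^{-1}\hat H\hat{\tilde S}^{-\top}$, with lower unitriangular $S,\tilde S,\hat S,\hat{\tilde S}$ and diagonal $H,\hat H$ with nonzero entries. $B=SX$, $A_a=H^{-1}\tilde SX_a$, $\hat B=\hat SX$, $\hat A_a=\hat H^{-1}\hat{\tilde S}X_a$, $a\in\{1,2\}$, with entries $B^{(n)},A_a^{(n)},\hat B^{(n)},\hat A_a^{(n)}$. Further, $$v_1^{(n)}(x)=P_{\mathrm e}(x)A_1^{(n)}(x)-xP_{\mathrm o}(x)A_2^{(n)}(x),\qquad v_2^{(n)}(x)=-P_{\mathrm o}(x)A_1^{(n)}(x)+P_{\mathrm e}(x)A_2^{(n)}(x),$$ $K_a^{(n)}(x,y)=\sum_{m=0}^{n-1}B^{(m)}(x)A_a^{(m)}(y)$, and $$k_1^{(n)}(x,y)=P_{\mathrm e}(y)K_1^{(n)}(x,y)-yP_{\mathrm o}(y)K_2^{(n)}(x,y),\qquad k_2^{(n)}(x,y)=-P_{\mathrm o}(y)K_1^{(n)}(x,y)+P_{\mathrm e}(y)K_2^{(n)}(x,y).$$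
   Formalization: With π = P_e² − xP_o² the printed type I formula has the wrong sign for odd N; the factor (−1)^Ñ is inserted on its right-hand side. Ñ ≥ 1 is assumed, and the type I formula is stated where π(y)p(y) ≠ 0. *)

theory Defs
  imports "HOL-Analysis.Set_Integral" "Jordan_Normal_Form.Determinant"
begin

text \<open>
  Semi-infinite matrices are functions of two indices in 0, 1, 2, ...; semi-infinite vectors of
  functions carry their argument first and their index second.
\<close>

definition lower_unitriangular :: "(nat \<Rightarrow> nat \<Rightarrow> real) \<Rightarrow> bool" where
  "lower_unitriangular L \<longleftrightarrow> (\<forall>i. L i i = 1) \<and> (\<forall>i j. i < j \<longrightarrow> L i j = 0)"

text \<open>The matrix product, for a lower triangular left factor: row \<open>i\<close> of \<open>L\<close> ends at column \<open>i\<close>.\<close>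

definition lt_mult :: "(nat \<Rightarrow> nat \<Rightarrow> real) \<Rightarrow> (nat \<Rightarrow> nat \<Rightarrow> real) \<Rightarrow> nat \<Rightarrow> nat \<Rightarrow> real" where
  "lt_mult L A = (\<lambda>i j. \<Sum>k\<le>i. L i k * A k j)"

definition lt_inverse :: "(nat \<Rightarrow> nat \<Rightarrow> real) \<Rightarrow> (nat \<Rightarrow> nat \<Rightarrow> real) \<Rightarrow> bool" where
  "lt_inverse S L \<longleftrightarrow> lower_unitriangular L
     \<and> lt_mult S L = (\<lambda>i j. if i = j then 1 else 0)
     \<and> lt_mult L S = (\<lambda>i j. if i = j then 1 else 0)"

text \<open>
  \<open>g = S\<^sup>-\<^sup>1 H T\<^sup>-\<^sup>t\<close> with \<open>L = S\<^sup>-\<^sup>1\<close>, \<open>K = T\<^sup>-\<^sup>1\<close>; the diagonal matrix \<open>H\<close> is given by its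
  diagonal.
\<close>

definition gauss_borel ::
  "(nat \<Rightarrow> nat \<Rightarrow> real) \<Rightarrow> (nat \<Rightarrow> nat \<Rightarrow> real) \<Rightarrow> (nat \<Rightarrow> real) \<Rightarrow> (nat \<Rightarrow> nat \<Rightarrow> real) \<Rightarrow> bool" where
  "gauss_borel g S H T \<longleftrightarrow> lower_unitriangular S \<and> lower_unitriangular T \<and> (\<forall>n. H n \<noteq> 0)
     \<and> (\<exists>L K. lt_inverse S L \<and> lt_inverse T K \<and> g = lt_mult L (\<lambda>i j. H i * K j i))"

definition monomials :: "'a::comm_semiring_1 \<Rightarrow> nat \<Rightarrow> 'a" where
  "monomials x j = x ^ j"

text \<open>\<open>X\<^sub>1 = (1, 0, x, 0, x\<^sup>2, ...)\<close> and \<open>X\<^sub>2 = (0, 1, 0, x, 0, x\<^sup>2, ...)\<close>; the index \<open>a\<close> is 1 or 2.\<close>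

definition split_monomials :: "nat \<Rightarrow> 'a::comm_semiring_1 \<Rightarrow> nat \<Rightarrow> 'a" where
  "split_monomials a x j = (if (if a = 1 then even j else odd j) then x ^ (j div 2) else 0)"

definition moment_matrix ::
  "real measure \<Rightarrow> real set \<Rightarrow> (real \<Rightarrow> real) \<Rightarrow> (real \<Rightarrow> real) \<Rightarrow> nat \<Rightarrow> nat \<Rightarrow> real" where
  "moment_matrix \<mu> \<Delta> u1 u2 i j =
     (LINT x:\<Delta>|\<mu>. monomials x i * (split_monomials 1 x j * u1 x + split_monomials 2 x j * u2 x))"

text \<open>The entries of \<open>S X\<close> and of \<open>H\<^sup>-\<^sup>1 T X\<^sub>a\<close>, as functions of a complex variable.\<close>

definition typeII_poly :: "(nat \<Rightarrow> nat \<Rightarrow> real) \<Rightarrow> nat \<Rightarrow> complex \<Rightarrow> complex" where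
  "typeII_poly S n x = (\<Sum>k\<le>n. of_real (S n k) * monomials x k)"

definition typeI_poly ::
  "(nat \<Rightarrow> real) \<Rightarrow> (nat \<Rightarrow> nat \<Rightarrow> real) \<Rightarrow> nat \<Rightarrow> nat \<Rightarrow> complex \<Rightarrow> complex" where
  "typeI_poly H T a n y = inverse (of_real (H n)) * (\<Sum>k\<le>n. of_real (T n k) * split_monomials a y k)"

text \<open>\<open>K\<^sub>a\<close> at \<open>(x, y)\<close>, of order \<open>n\<close>.\<close>

definition cd_kernel ::
  "(nat \<Rightarrow> nat \<Rightarrow> real) \<Rightarrow> (nat \<Rightarrow> real) \<Rightarrow> (nat \<Rightarrow> nat \<Rightarrow> real) \<Rightarrow> nat \<Rightarrow> nat \<Rightarrow> complex \<Rightarrow> complex \<Rightarrow> complex"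
  where
  "cd_kernel S H T a n x y = (\<Sum>m<n. typeII_poly S m x * typeI_poly H T a m y)"

abbreviation cpoly :: "real poly \<Rightarrow> complex poly" where
  "cpoly q \<equiv> map_poly complex_of_real q"

text \<open>
  The combination of a pair \<open>f 1\<close>, \<open>f 2\<close> that turns \<open>A\<^sub>1\<close>, \<open>A\<^sub>2\<close> into \<open>v\<^sub>1\<close>, \<open>v\<^sub>2\<close> and \<open>K\<^sub>1\<close>, \<open>K\<^sub>2\<close> into
  \<open>k\<^sub>1\<close>, \<open>k\<^sub>2\<close>.
\<close>

definition mixed ::
  "real poly \<Rightarrow> real poly \<Rightarrow> (nat \<Rightarrow> complex \<Rightarrow> complex) \<Rightarrow> nat \<Rightarrow> complex \<Rightarrow> complex" where
  "mixed Pe Po f a y =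
     (if a = 1 then poly (cpoly Pe) y * f 1 y - y * poly (cpoly Po) y * f 2 y
      else - poly (cpoly Po) y * f 1 y + poly (cpoly Pe) y * f 2 y)"

text \<open>The row of values at the nodes that gives \<open>R\<^sub>l\<close> from \<open>v\<^sub>1\<close>, \<open>v\<^sub>2\<close> and \<open>\<^bold>k\<close> from \<open>k\<^sub>1\<close>, \<open>k\<^sub>2\<close>.\<close>

definition node_row ::
  "nat \<Rightarrow> nat \<Rightarrow> (nat \<Rightarrow> complex) \<Rightarrow> (nat \<Rightarrow> complex) \<Rightarrow> (nat \<Rightarrow> complex \<Rightarrow> complex) \<Rightarrow> complex list" where
  "node_row M N r \<xi> f =
     map (\<lambda>i. f 1 ((r i)\<^sup>2)) [0..<M] @ map (\<lambda>i. f 2 ((r i)\<^sup>2)) [0..<M] @ map (\<lambda>i. f 2 ((\<xi> i)\<^sup>2)) [0..<N]"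

text \<open>Determinant of a \<open>d \<times> d\<close> matrix given by the list of its \<open>d\<close> rows.\<close>

definition rows_det :: "nat \<Rightarrow> complex list list \<Rightarrow> complex" where
  "rows_det d rs = Determinant.det (mat_of_rows_list d rs)"

end

theory Submission
  imports Defs
begin

text \<open>
  Let \<open>\<Lambda>\<close> be the shift matrix. Then \<open>g\<^bsub>w'\<^esub> = g\<^bsub>w\<^esub> Q(\<Lambda>)\<^sup>t\<close> with \<open>Q(x) = p(x\<^sup>2) P(x)\<close>, so the matrix \<open>\<Omega>\<close>
  connecting \<open>B = \<Omega> B'\<close> is lower unitriangular with only \<open>d\<close> nonzero subdiagonals, and
  \<open>\<Omega>\<^sup>t v\<^sub>a = p \<pi> A'\<^sub>a\<close>. At the nodes the right-hand side vanishes, hence each \<open>R\<^sub>l\<close> and each kernel row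
  is an explicit combination of the next \<open>d\<close> rows; the determinant formulas are Cramer's rule
  for these relations.

  The same relations give \<open>\<tau>\<^sub>m = (-1)\<^sup>d \<Omega>\<^bsub>m+d,m\<^esub> \<tau>\<^bsub>m+1\<^esub>\<close> with \<open>\<Omega>\<^bsub>m+d,m\<^esub> \<noteq> 0\<close>, so it is enough that
  \<open>\<tau>\<^sub>0 \<noteq> 0\<close>. A linear relation between \<open>R\<^sub>0, ..., R\<^bsub>d-1\<^esub>\<close> yields a polynomial
  \<open>F(z) = F\<^sub>1(z\<^sup>2) + z F\<^sub>2(z\<^sup>2)\<close> of degree below \<open>d\<close> for which \<open>p(z\<^sup>2) P(z) P(-z)\<close> divides \<open>P(-z) F(z)\<close>,
  and therefore \<open>F = 0\<close>.
\<close>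

section \<open>The connection matrix\<close>

text \<open>The linear functional sending x^k to \<open>s k\<close>, applied to \<open>F\<close>.
  For \<open>s = (\<lambda>k. f (j + k))\<close> it is entry \<open>j\<close> of F(\<Lambda>) f,
  with \<Lambda> the shift.\<close>

definition coeff_pairing :: "real poly \<Rightarrow> (nat \<Rightarrow> 'a::real_normed_field) \<Rightarrow> 'a" where
  "coeff_pairing F s = (\<Sum>k\<le>degree F. of_real (coeff F k) * s k)"

lemma coeff_pairing_bound:
  "degree F \<le> D \<Longrightarrow> coeff_pairing F s = (\<Sum>k\<le>D. of_real (coeff F k) * s k)"
  unfolding coeff_pairing_def by (rule sum.mono_neutral_left) (auto simp: coeff_eq_0)

lemma coeff_pairing_0 [simp]: "coeff_pairing 0 s = 0"
  by (simp add: coeff_pairing_def)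

lemma coeff_pairing_add: "coeff_pairing (F + G) s = coeff_pairing F s + coeff_pairing G s"
proof -
  let ?D = "max (degree F) (degree G)"
  have "degree (F + G) \<le> ?D" "degree F \<le> ?D" "degree G \<le> ?D"
    by (simp_all add: degree_add_le_max)
  then show ?thesis
    by (simp add: coeff_pairing_bound[of _ ?D] sum.distrib algebra_simps)
qed

lemma coeff_pairing_pCons:
  "coeff_pairing (pCons a F) s = of_real a * s 0 + coeff_pairing F (\<lambda>k. s (Suc k))"
proof -
  have "degree (pCons a F) \<le> Suc (degree F)" by (simp add: degree_pCons_le)
  then have "coeff_pairing (pCons a F) s
      = (\<Sum>k\<le>Suc (degree F). of_real (coeff (pCons a F) k) * s k)"
    by (rule coeff_pairing_bound)
  also have "\<dots> = of_real a * s 0 + coeff_pairing F (\<lambda>k. s (Suc k))"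
    by (subst sum.atMost_Suc_shift) (simp add: coeff_pairing_def)
  finally show ?thesis .
qed

lemma coeff_pairing_mult: "coeff_pairing F (\<lambda>k. c * s k) = c * coeff_pairing F s"
  by (simp add: coeff_pairing_def sum_distrib_left mult.left_commute)

text \<open>F(x^2) meets only the even entries of \<open>s\<close>, which by the recurrence are x^k
  \<open>s 0\<close>; the functional therefore evaluates \<open>F\<close> at
  \<open>x\<close>.\<close>

lemma coeff_pairing_pcompose_square:
  assumes "\<And>k. s (Suc (Suc k)) = x * s k"
  shows "coeff_pairing (F \<circ>\<^sub>p [:0, 0, 1:]) s = poly (map_poly of_real F) x * s 0"
proof (induction F)
  case 0
  then show ?case by simp
next
  case (pCons a F)
  have "pCons a F \<circ>\<^sub>p [:0, 0, 1:] = pCons a (pCons 0 (F \<circ>\<^sub>p [:0, 0, 1:]))"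
    by (simp add: pcompose_pCons)
  then show ?case
    by (simp add: coeff_pairing_pCons assms coeff_pairing_mult pCons.IH map_poly_pCons
        algebra_simps)
qed

lemma coeff_pairing_even_odd:
  assumes "\<And>k. s (Suc (Suc k)) = x * s k"
  shows "coeff_pairing (F \<circ>\<^sub>p [:0, 0, 1:] + [:0, 1:] * (G \<circ>\<^sub>p [:0, 0, 1:])) s
    = poly (map_poly of_real F) x * s 0 + poly (map_poly of_real G) x * s 1"
proof -
  have "[:0, 1:] * (G \<circ>\<^sub>p [:0, 0, 1:]) = pCons 0 (G \<circ>\<^sub>p [:0, 0, 1:])" by simp
  then show ?thesis
    using coeff_pairing_pcompose_square[where s = s and x = x and F = F]
      coeff_pairing_pcompose_square[where s = "\<lambda>k. s (Suc k)" and x = x and F = G] assms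
    by (simp add: coeff_pairing_add coeff_pairing_pCons)
qed

lemma split_monomials_Suc:
  "split_monomials 1 x (Suc j) = x * split_monomials 2 x j"
  "split_monomials 2 x (Suc j) = split_monomials 1 x j"
  by (auto simp: split_monomials_def elim!: oddE)

text \<open>The shift swaps X_1 and X_2 up to a factor x, so \<Lambda>^2 acts on both as
  multiplication by x. Hence Q(\<Lambda>) acts on the pair by the matrix with rows (Qe, x Qo) and
  (Qo, Qe), whose determinant is Qe^2 - x Qo^2.\<close>

lemma split_monomials_shift:
  fixes Q Qe Qo :: "real poly" and x :: "'a::real_normed_field"
  assumes "Q = Qe \<circ>\<^sub>p [:0, 0, 1:] + [:0, 1:] * (Qo \<circ>\<^sub>p [:0, 0, 1:])" and "degree Q \<le> D"
  shows "(\<Sum>k\<le>D. of_real (coeff Q k) * split_monomials 1 x (j + k))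
      = poly (map_poly of_real Qe) x * split_monomials 1 x j
        + x * poly (map_poly of_real Qo) x * split_monomials 2 x j"
    and "(\<Sum>k\<le>D. of_real (coeff Q k) * split_monomials 2 x (j + k))
      = poly (map_poly of_real Qo) x * split_monomials 1 x j
        + poly (map_poly of_real Qe) x * split_monomials 2 x j"
proof -
  have "coeff_pairing Q (\<lambda>k. split_monomials a x (j + k))
      = poly (map_poly of_real Qe) x * split_monomials a x j
        + poly (map_poly of_real Qo) x * split_monomials a x (Suc j)" if "a \<in> {1, 2}" for a
    using that unfolding assms(1) by (subst coeff_pairing_even_odd[where x = x])
      (auto simp: split_monomials_Suc[simplified] split_monomials_Suc(1))
  then show "(\<Sum>k\<le>D. of_real (coeff Q k) * split_monomials 1 x (j + k))
      = poly (map_poly of_real Qe) x * split_monomials 1 x j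
        + x * poly (map_poly of_real Qo) x * split_monomials 2 x j"
    and "(\<Sum>k\<le>D. of_real (coeff Q k) * split_monomials 2 x (j + k))
      = poly (map_poly of_real Qo) x * split_monomials 1 x j
        + poly (map_poly of_real Qe) x * split_monomials 2 x j"
    using assms(2) by (auto simp: coeff_pairing_bound split_monomials_Suc simp del: One_nat_def)
qed

text \<open>Entrywise g' = g Q(\<Lambda>)^t: the weights enter linearly, so the action of
  Q(\<Lambda>) on X_1, X_2 can be transferred to them. Finiteness of the moments lets the finite sum
  pass through the integral.\<close>

lemma moment_matrix_christoffel:
  fixes Q Qe Qo :: "real poly"
  assumes Q: "Q = Qe \<circ>\<^sub>p [:0, 0, 1:] + [:0, 1:] * (Qo \<circ>\<^sub>p [:0, 0, 1:])" and D: "degree Q \<le> D"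
    and i1: "\<And>j. set_integrable \<mu> \<Delta> (\<lambda>x. x ^ j * w1 x)"
    and i2: "\<And>j. set_integrable \<mu> \<Delta> (\<lambda>x. x ^ j * w2 x)"
  shows "moment_matrix \<mu> \<Delta> (\<lambda>x. poly Qe x * w1 x + poly Qo x * w2 x)
      (\<lambda>x. x * poly Qo x * w1 x + poly Qe x * w2 x) i j
    = (\<Sum>k\<le>D. coeff Q k * moment_matrix \<mu> \<Delta> w1 w2 i (j + k))"
proof -
  have "set_integrable \<mu> \<Delta> (\<lambda>x. monomials x i * (split_monomials a x l * w x))"
    if "\<And>j. set_integrable \<mu> \<Delta> (\<lambda>x. x ^ j * w x)" for a l and w :: "real \<Rightarrow> real"
    using that[of "i + l div 2"]
    by (cases "if a = 1 then even l else odd l")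
      (simp_all add: monomials_def power_add mult.assoc split_monomials_def set_integrable_def
        if_distrib cong: if_cong)
  note int = this[OF i1] this[OF i2]
  let ?f = "\<lambda>l x. monomials x i * (split_monomials 1 x l * w1 x + split_monomials 2 x l * w2 x)"
  have intf: "set_integrable \<mu> \<Delta> (?f l)" for l
    using set_integral_add(1)[OF int(1)[of 1 l] int(2)[of 2 l]] by (simp add: distrib_left)
  have "(\<Sum>k\<le>D. coeff Q k * moment_matrix \<mu> \<Delta> w1 w2 i (j + k))
      = (\<integral>x. (\<Sum>k\<le>D. coeff Q k * (indicator \<Delta> x *\<^sub>R ?f (j + k) x)) \<partial>\<mu>)"
    using intf unfolding moment_matrix_def set_lebesgue_integral_def set_integrable_def
    by (subst Bochner_Integration.integral_sum) auto
  also have "(\<lambda>x. \<Sum>k\<le>D. coeff Q k * (indicator \<Delta> x *\<^sub>R ?f (j + k) x))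
      = (\<lambda>x. indicator \<Delta> x *\<^sub>R (monomials x i
        * ((\<Sum>k\<le>D. coeff Q k * split_monomials 1 x (j + k)) * w1 x
          + (\<Sum>k\<le>D. coeff Q k * split_monomials 2 x (j + k)) * w2 x)))"
    by (simp add: sum_distrib_left sum_distrib_right sum.distrib algebra_simps)
  also have "(\<integral>x. \<dots> x \<partial>\<mu>) = moment_matrix \<mu> \<Delta> (\<lambda>x. poly Qe x * w1 x + poly Qo x * w2 x)
      (\<lambda>x. x * poly Qo x * w1 x + poly Qe x * w2 x) i j"
    unfolding moment_matrix_def set_lebesgue_integral_def
      split_monomials_shift[OF Q D, where ?'a = real, unfolded of_real_eq_id id_apply map_poly_id']
    by (intro Bochner_Integration.integral_cong refl) (simp add: algebra_simps)
  finally show ?thesis by simp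
qed

section \<open>Lower triangular matrices and Gauss-Borel factors\<close>

lemma lt_mult_assoc:
  fixes X :: "nat \<Rightarrow> 'a::real_normed_field"
  assumes "lower_unitriangular B"
  shows "(\<Sum>k\<le>i. of_real (A i k) * (\<Sum>l\<le>k. of_real (B k l) * X l))
    = (\<Sum>l\<le>i. of_real (lt_mult A B i l) * X l)"
proof -
  \<comment> \<open>The zeros of \<open>B\<close> above the diagonal let every inner sum run up to
    the common bound \<open>i\<close>; then the sums can be exchanged.\<close>
  have "(\<Sum>l\<le>k. of_real (B k l) * X l) = (\<Sum>l\<le>i. of_real (B k l) * X l)" if "k \<le> i" for k
    by (rule sum.mono_neutral_left) (use that assms in \<open>auto simp: lower_unitriangular_def\<close>)
  then have "(\<Sum>k\<le>i. of_real (A i k) * (\<Sum>l\<le>k. of_real (B k l) * X l))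
      = (\<Sum>k\<le>i. \<Sum>l\<le>i. of_real (A i k) * (of_real (B k l) * X l))"
    by (simp add: sum_distrib_left)
  also have "\<dots> = (\<Sum>l\<le>i. \<Sum>k\<le>i. of_real (A i k) * (of_real (B k l) * X l))"
    by (rule sum.swap)
  finally show ?thesis by (simp add: lt_mult_def sum_distrib_right mult.assoc)
qed

lemma lt_mult_inverse_apply:
  fixes X :: "nat \<Rightarrow> 'a::real_normed_field"
  assumes "lower_unitriangular B" and "lt_mult A B = (\<lambda>i j. if i = j then 1 else 0)"
  shows "(\<Sum>k\<le>i. of_real (A i k) * (\<Sum>l\<le>k. of_real (B k l) * X l)) = X i"
proof -
  have "(\<Sum>l\<le>i. of_real (if i = l then 1 else 0) * X l) = (\<Sum>l\<le>i. if l = i then X l else 0)"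
    by (intro sum.cong) auto
  then show ?thesis by (simp add: lt_mult_assoc[OF assms(1)] assms(2))
qed

lemma lower_unitriangular_lt_mult:
  assumes "lower_unitriangular A" and "lower_unitriangular B"
  shows "lower_unitriangular (lt_mult A B)"
proof -
  have "lt_mult A B i i = 1" for i
  proof -
    have "lt_mult A B i i = (\<Sum>k\<le>i. if k = i then 1 else 0)"
      unfolding lt_mult_def
      by (rule sum.cong) (use assms in \<open>auto simp: lower_unitriangular_def\<close>)
    then show ?thesis by simp
  qed
  moreover have "lt_mult A B i j = 0" if "i < j" for i j
    unfolding lt_mult_def
    by (rule sum.neutral) (use assms that in \<open>auto simp: lower_unitriangular_def\<close>)
  ultimately show ?thesis by (simp add: lower_unitriangular_def)
qed

text \<open>The form in which the factorization is used: S g = H K^t with K = T^-1, obtained by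
  cancelling \<open>L\<close> against \<open>S\<close>.\<close>

lemma gauss_borelE:
  assumes "gauss_borel g S H T"
  obtains L K where "lower_unitriangular S" "lower_unitriangular T" "\<forall>n. H n \<noteq> 0"
    "lt_inverse S L" "lt_inverse T K"
    "\<forall>i j. (\<Sum>k\<le>i. S i k * g k j) = H i * K j i"
proof -
  from assms obtain L K where *: "lower_unitriangular S" "lower_unitriangular T" "\<forall>n. H n \<noteq> 0"
    "lt_inverse S L" "lt_inverse T K" "g = lt_mult L (\<lambda>i j. H i * K j i)"
    unfolding gauss_borel_def by auto
  have "(\<Sum>k\<le>i. S i k * g k j) = H i * K j i" for i j
    using lt_mult_inverse_apply[of L S i "\<lambda>i. H i * K j i"] *(4)
    by (simp add: *(6) lt_mult_def lt_inverse_def)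
  with * show ?thesis using that by blast
qed

text \<open>\<open>\<Omega> = S S'\<^sup>-\<^sup>1\<close> equals \<open>H T\<^sup>-\<^sup>t Q(\<Lambda>)\<^sup>t T'\<^sup>t H'\<^sup>-\<^sup>1\<close> for the shift matrix \<open>\<Lambda>\<close>; the second form has
  only \<open>D\<close> nonzero subdiagonals.\<close>

lemma christoffel_connection:
  fixes q :: "nat \<Rightarrow> real"
  assumes gb: "gauss_borel g S H T" and gb': "gauss_borel g' S' H' T'"
    and g': "\<And>i j. g' i j = (\<Sum>k\<le>D. q k * g i (j + k))" and q: "q D \<noteq> 0"
  obtains \<Omega> where "lower_unitriangular \<Omega>" "\<And>m. \<Omega> (m + D) m \<noteq> 0"
    "\<And>l m. m + D < l \<Longrightarrow> \<Omega> l m = 0"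
    "\<And>n x. typeII_poly S n x = (\<Sum>m\<le>n. of_real (\<Omega> n m) * typeII_poly S' m x)"
    "\<And>m a x. (\<Sum>l\<le>m + D. of_real (\<Omega> l m) * typeI_poly H T a l x)
      = inverse (of_real (H' m))
        * (\<Sum>j\<le>m. of_real (T' m j) * (\<Sum>k\<le>D. of_real (q k) * split_monomials a x (j + k)))"
proof -
  from gb obtain L K where S: "lower_unitriangular S" "lower_unitriangular T" "\<forall>n. H n \<noteq> 0"
    "lt_inverse S L" "lt_inverse T K" and Sg: "\<forall>i j. (\<Sum>k\<le>i. S i k * g k j) = H i * K j i"
    by (rule gauss_borelE)
  from gb' obtain L' K' where S': "lower_unitriangular S'" "lower_unitriangular T'"
    "\<forall>n. H' n \<noteq> 0" "lt_inverse S' L'" "lt_inverse T' K'"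
    and Sg': "\<forall>i j. (\<Sum>k\<le>i. S' i k * g' k j) = H' i * K' j i"
    by (rule gauss_borelE)
  have K: "lower_unitriangular K" and L': "lower_unitriangular L'"
    using S S' by (auto simp: lt_inverse_def)
  define \<Omega> where "\<Omega> = lt_mult S L'"
  have \<Omega>: "lower_unitriangular \<Omega>"
    unfolding \<Omega>_def by (rule lower_unitriangular_lt_mult[OF S(1) L'])
  \<comment> \<open>S = \<open>\<Omega>\<close> S' in applied form. It serves twice: on the columns
    of \<open>g'\<close> over the reals, and on the monomials over the complex numbers.\<close>
  have S_apply: "(\<Sum>k\<le>i. of_real (S i k) * X k)
      = (\<Sum>m\<le>i. of_real (\<Omega> i m) * (\<Sum>k\<le>m. of_real (S' m k) * X k))"
    for i and X :: "nat \<Rightarrow> 'a::real_normed_field"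
  proof -
    have "(\<Sum>m\<le>i. of_real (\<Omega> i m) * (\<Sum>k\<le>m. of_real (S' m k) * X k))
        = (\<Sum>k\<le>i. of_real (S i k) * (\<Sum>m\<le>k. of_real (L' k m) * (\<Sum>l\<le>m. of_real (S' m l) * X l)))"
      unfolding \<Omega>_def by (rule lt_mult_assoc[OF L', symmetric])
    also have "\<dots> = (\<Sum>k\<le>i. of_real (S i k) * X k)"
      using S'(4) by (simp only: lt_mult_inverse_apply[OF S'(1)] lt_inverse_def)
    finally show ?thesis by simp
  qed
  \<comment> \<open>Two expressions for S g' are compared: H K^t Q(\<Lambda>)^t and
    \<open>\<Omega>\<close> H' K'^t. Multiplication by T'^t then cancels K'^t.\<close>
  have key: "\<Omega> l m * H' m = H l * (\<Sum>j\<le>m. T' m j * (\<Sum>k\<le>D. q k * K (j + k) l))" for l m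
  proof -
    have 1: "H l * (\<Sum>k\<le>D. q k * K (j + k) l) = (\<Sum>i\<le>l. \<Omega> l i * H' i * K' j i)" for j
    proof -
      have "(\<Sum>k\<le>l. S l k * g' k j) = (\<Sum>k\<le>D. q k * (\<Sum>i\<le>l. S l i * g i (j + k)))"
        unfolding g' sum_distrib_left by (subst sum.swap) (simp add: mult.left_commute)
      moreover have "(\<Sum>k\<le>l. S l k * g' k j) = (\<Sum>i\<le>l. \<Omega> l i * (H' i * K' j i))"
        using S_apply[of l "\<lambda>k. g' k j"] by (simp add: Sg')
      ultimately show ?thesis
        by (simp add: Sg sum_distrib_left mult.assoc mult.left_commute)
    qed
    have "H l * (\<Sum>j\<le>m. T' m j * (\<Sum>k\<le>D. q k * K (j + k) l))
        = (\<Sum>j\<le>m. T' m j * (H l * (\<Sum>k\<le>D. q k * K (j + k) l)))"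
      by (simp add: sum_distrib_left mult.left_commute)
    also have "\<dots> = (\<Sum>j\<le>m. \<Sum>i\<le>l. \<Omega> l i * H' i * (T' m j * K' j i))"
      by (simp only: 1) (simp add: sum_distrib_left mult_ac)
    also have "\<dots> = (\<Sum>i\<le>l. \<Omega> l i * H' i * lt_mult T' K' m i)"
      by (subst sum.swap) (simp add: lt_mult_def sum_distrib_left)
    also have "\<dots> = (\<Sum>i\<le>l. if i = m then \<Omega> l i * H' i else 0)"
      using S'(5) by (intro sum.cong) (auto simp: lt_inverse_def)
    also have "\<dots> = \<Omega> l m * H' m"
      using \<Omega> by (auto simp: lower_unitriangular_def)
    finally show ?thesis by simp
  qed
  show ?thesis
  proof
    show "lower_unitriangular \<Omega>" by fact
    show "\<Omega> (m + D) m \<noteq> 0" for m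
    proof -
      \<comment> \<open>Only the pair j = m, k = D reaches the diagonal of \<open>K\<close>; all
        other entries lie above it and vanish.\<close>
      have "(\<Sum>k\<le>D. q k * K (j + k) (m + D)) = (if j = m then q D else 0)" if "j \<le> m" for j
      proof -
        have "(\<Sum>k\<le>D. q k * K (j + k) (m + D)) = (\<Sum>k\<le>D. if k = D then if j = m then q D else 0 else 0)"
          using K that by (intro sum.cong) (auto simp: lower_unitriangular_def)
        then show ?thesis by simp
      qed
      then have "(\<Sum>j\<le>m. T' m j * (\<Sum>k\<le>D. q k * K (j + k) (m + D)))
          = (\<Sum>j\<le>m. if j = m then T' m j * q D else 0)"
        by (intro sum.cong) auto
      also have "\<dots> = q D" using S'(2) by (simp add: lower_unitriangular_def)
      finally show ?thesis using key[of "m + D" m] q S(3)[rule_format, of "m + D"] by auto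
    qed
    show "\<Omega> l m = 0" if "m + D < l" for l m
    proof -
      have "(\<Sum>j\<le>m. T' m j * (\<Sum>k\<le>D. q k * K (j + k) l)) = 0"
        using K that by (intro sum.neutral) (auto simp: lower_unitriangular_def intro!: sum.neutral)
      then show ?thesis using key[of l m] S'(3)[rule_format, of m] by auto
    qed
    show "typeII_poly S n x = (\<Sum>m\<le>n. of_real (\<Omega> n m) * typeII_poly S' m x)" for n x
      unfolding typeII_poly_def by (rule S_apply)
    show "(\<Sum>l\<le>m + D. of_real (\<Omega> l m) * typeI_poly H T a l x)
      = inverse (of_real (H' m))
        * (\<Sum>j\<le>m. of_real (T' m j) * (\<Sum>k\<le>D. of_real (q k) * split_monomials a x (j + k)))"
      for m a x
    proof -
      \<comment> \<open>\<open>U\<close> is T X_a, so that A_a = H^-1 \<open>U\<close>, and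
        \<open>K\<close> recovers X_a from it. The range up to m + D covers every index j + k that
        occurs.\<close>
      define U where "U l = (\<Sum>i\<le>l. of_real (T l i) * split_monomials a x i)" for l
      have KU: "(\<Sum>l\<le>m + D. of_real (K i l) * U l) = split_monomials a x i" if "i \<le> m + D" for i
      proof -
        have "(\<Sum>l\<le>m + D. of_real (K i l) * U l) = (\<Sum>l\<le>i. of_real (K i l) * U l)"
          by (rule sum.mono_neutral_right) (use that K in \<open>auto simp: lower_unitriangular_def\<close>)
        also have "\<dots> = split_monomials a x i"
          unfolding U_def using S(5) by (simp add: lt_mult_inverse_apply[OF S(2)] lt_inverse_def)
        finally show ?thesis .
      qed
      have "of_real (\<Omega> l m) * typeI_poly H T a l x
          = inverse (of_real (H' m)) * (\<Sum>j\<le>m. \<Sum>k\<le>D.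
             of_real (T' m j) * of_real (q k) * (of_real (K (j + k) l) * U l))" for l
      proof -
        have "\<Omega> l m = H l * inverse (H' m) * (\<Sum>j\<le>m. T' m j * (\<Sum>k\<le>D. q k * K (j + k) l))"
          using key[of l m] S'(3)[rule_format, of m] by (simp add: field_simps)
        then have "complex_of_real (\<Omega> l m) * typeI_poly H T a l x
            = inverse (of_real (H' m))
              * (of_real (\<Sum>j\<le>m. T' m j * (\<Sum>k\<le>D. q k * K (j + k) l)) * U l)"
          using S(3)[rule_format, of l] by (simp add: typeI_poly_def U_def)
        then show ?thesis
          by (simp add: sum_distrib_left sum_distrib_right mult_ac)
      qed
      then have "(\<Sum>l\<le>m + D. of_real (\<Omega> l m) * typeI_poly H T a l x)
          = inverse (of_real (H' m)) * (\<Sum>l\<le>m + D. \<Sum>j\<le>m. \<Sum>k\<le>D.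
             of_real (T' m j) * of_real (q k) * (of_real (K (j + k) l) * U l))"
        by (simp add: sum_distrib_left)
      also have "(\<Sum>l\<le>m + D. \<Sum>j\<le>m. \<Sum>k\<le>D.
             of_real (T' m j) * of_real (q k) * (of_real (K (j + k) l) * U l))
          = (\<Sum>j\<le>m. \<Sum>k\<le>D. \<Sum>l\<le>m + D.
             of_real (T' m j) * of_real (q k) * (of_real (K (j + k) l) * U l))"
        by (subst sum.swap, rule sum.cong[OF refl], rule sum.swap)
      also have "\<dots> = (\<Sum>j\<le>m. of_real (T' m j) * (\<Sum>k\<le>D. of_real (q k) * split_monomials a x (j + k)))"
        by (simp add: KU mult.assoc flip: sum_distrib_left)
      finally show ?thesis .
    qed
  qed
qed

section \<open>Determinants of rows with a linear relation\<close>

text \<open>The matrix factors through \<open>C\<close>, with first row \<open>c\<close> and ones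
  just below the diagonal. The last column of \<open>C\<close> has only its top entry
  \<open>c e\<close>, and deleting that row and column leaves the identity, so det C = (-1)^e
  c_e.\<close>

lemma det_Cons_combination:
  fixes f :: "nat \<Rightarrow> nat \<Rightarrow> 'a::comm_ring_1"
  assumes x: "\<And>j. j < Suc e \<Longrightarrow> x j = (\<Sum>l<Suc e. c l * f l j)"
  shows "Determinant.det (mat (Suc e) (Suc e) (\<lambda>(i, j). if i = 0 then x j else f (i - 1) j))
    = (- 1) ^ e * c e * Determinant.det (mat (Suc e) (Suc e) (\<lambda>(i, j). f i j))"
proof -
  let ?m = "Suc e"
  define C where "C = mat ?m ?m (\<lambda>(i, l). if i = 0 then c l else if l = i - 1 then 1 else 0)"
  define F where "F = mat ?m ?m (\<lambda>(i, j). f i j)"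
  have C: "C \<in> carrier_mat ?m ?m" and F: "F \<in> carrier_mat ?m ?m" by (auto simp: C_def F_def)
  have "mat ?m ?m (\<lambda>(i, j). if i = 0 then x j else f (i - 1) j) = C * F"
  proof (rule eq_matI)
    fix i j assume "i < dim_row (C * F)" "j < dim_col (C * F)"
    then have ij: "i < ?m" "j < ?m" using C F by auto
    have "(C * F) $$ (i, j) = (\<Sum>l<?m. C $$ (i, l) * F $$ (l, j))"
      using ij C F by (auto simp: times_mat_def scalar_prod_def atLeast0LessThan intro!: sum.cong)
    also have "\<dots> = (\<Sum>l<?m. if i = 0 then c l * f l j else if l = i - 1 then f l j else 0)"
      by (rule sum.cong) (use ij in \<open>auto simp: C_def F_def\<close>)
    also have "\<dots> = (if i = 0 then x j else f (i - 1) j)"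
      using ij x by (cases "i = 0") auto
    finally show "mat ?m ?m (\<lambda>(i, j). if i = 0 then x j else f (i - 1) j) $$ (i, j) = (C * F) $$ (i, j)"
      using ij by simp
  qed (use C F in auto)
  moreover have "Determinant.det C = (- 1) ^ e * c e"
  proof -
    have "Determinant.det C = (\<Sum>i<?m. C $$ (i, e) * cofactor C i e)"
      by (rule laplace_expansion_column[OF C]) simp
    also have "\<dots> = (\<Sum>i<?m. if i = 0 then c e * cofactor C 0 e else 0)"
      by (rule sum.cong) (auto simp: C_def)
    also have "\<dots> = c e * cofactor C 0 e" by simp
    also have "mat_delete C 0 e = 1\<^sub>m e"
      by (rule eq_matI) (auto simp: mat_delete_def C_def)
    then have "cofactor C 0 e = (- 1) ^ e" by (simp add: cofactor_def)
    finally show ?thesis by (simp add: mult.commute)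
  qed
  ultimately show ?thesis using det_mult[OF C F] by (simp add: F_def)
qed

text \<open>Since \<open>c 0 = 1\<close>, replacing row 0 by the combination keeps the determinant.
  The new row is \<open>s\<close> times the last unit vector, and expansion along it gives the sign
  (-1)^e.\<close>

lemma det_row_combination_unit:
  fixes f :: "nat \<Rightarrow> nat \<Rightarrow> 'a::comm_ring_1"
  assumes c: "c 0 = 1"
    and s: "\<And>j. j < Suc e \<Longrightarrow> (\<Sum>l<Suc e. c l * f l j) = (if j = e then s else 0)"
  shows "Determinant.det (mat (Suc e) (Suc e) (\<lambda>(i, j). f i j))
    = (- 1) ^ e * s * Determinant.det (mat e e (\<lambda>(i, j). f (Suc i) j))"
proof -
  let ?m = "Suc e"
  define C where "C = mat ?m ?m (\<lambda>(i, l). if i = 0 then c l else if l = i then 1 else 0)"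
  define F where "F = mat ?m ?m (\<lambda>(i, j). f i j)"
  define G where "G = mat ?m ?m (\<lambda>(i, j). if i = 0 then if j = e then s else 0 else f i j)"
  have C: "C \<in> carrier_mat ?m ?m" and F: "F \<in> carrier_mat ?m ?m" and G: "G \<in> carrier_mat ?m ?m"
    by (auto simp: C_def F_def G_def)
  have "G = C * F"
  proof (rule eq_matI)
    fix i j assume "i < dim_row (C * F)" "j < dim_col (C * F)"
    then have ij: "i < ?m" "j < ?m" using C F by auto
    have "(C * F) $$ (i, j) = (\<Sum>l<?m. C $$ (i, l) * F $$ (l, j))"
      using ij C F by (auto simp: times_mat_def scalar_prod_def atLeast0LessThan intro!: sum.cong)
    also have "\<dots> = (\<Sum>l<?m. if i = 0 then c l * f l j else if l = i then f l j else 0)"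
      by (rule sum.cong) (use ij in \<open>auto simp: C_def F_def\<close>)
    also have "\<dots> = (if i = 0 then if j = e then s else 0 else f i j)"
      using ij s by (cases "i = 0") (auto simp del: sum.lessThan_Suc simp: sum.delta)
    finally show "G $$ (i, j) = (C * F) $$ (i, j)"
      using ij by (simp add: G_def)
  qed (use C F G in auto)
  moreover have "Determinant.det C = 1"
  proof -
    have "upper_triangular C" by (auto simp: C_def)
    then have "Determinant.det C = prod_list (diag_mat C)"
      by (rule det_upper_triangular[OF _ C])
    also have "\<dots> = (\<Prod>i = 0..<?m. C $$ (i, i))"
      using C by (simp add: prod_list_diag_prod)
    also have "\<dots> = 1" by (rule prod.neutral) (auto simp: C_def c)
    finally show ?thesis .
  qed
  moreover have "Determinant.det G = (- 1) ^ e * s * Determinant.det (mat e e (\<lambda>(i, j). f (Suc i) j))"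
  proof -
    have "Determinant.det G = (\<Sum>j<?m. G $$ (0, j) * cofactor G 0 j)"
      by (rule laplace_expansion_row[OF G]) simp
    also have "\<dots> = (\<Sum>j<?m. if j = e then s * cofactor G 0 e else 0)"
      by (rule sum.cong) (auto simp: G_def)
    also have "\<dots> = s * cofactor G 0 e" by simp
    also have "mat_delete G 0 e = mat e e (\<lambda>(i, j). f (Suc i) j)"
      by (rule eq_matI) (auto simp: mat_delete_def G_def)
    then have "cofactor G 0 e = (- 1) ^ e * Determinant.det (mat e e (\<lambda>(i, j). f (Suc i) j))"
      by (simp add: cofactor_def)
    finally show ?thesis by (simp add: mult_ac)
  qed
  ultimately show ?thesis using det_mult[OF C F] by (simp add: F_def)
qed

lemma rows_det_map_upt:
  "rows_det d (map g [a..<a + d]) = Determinant.det (mat d d (\<lambda>(i, j). g (a + i) ! j))"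
  unfolding rows_det_def mat_of_rows_list_def by (rule arg_cong[where f = Determinant.det]) auto

lemma rows_det_Cons_map_upt:
  "rows_det (Suc e) (x # map g [a..<a + e])
    = Determinant.det (mat (Suc e) (Suc e) (\<lambda>(i, j). if i = 0 then x ! j else g (a + (i - 1)) ! j))"
  unfolding rows_det_def mat_of_rows_list_def
  by (rule arg_cong[where f = Determinant.det], rule eq_matI) (auto simp: nth_Cons')

lemma det_eq_0_imp_row_combination:
  fixes f :: "nat \<Rightarrow> nat \<Rightarrow> 'a::field"
  assumes "Determinant.det (mat d d (\<lambda>(i, j). f i j)) = 0"
  obtains c where "\<exists>l<d. c l \<noteq> 0" "\<forall>j<d. (\<Sum>l<d. c l * f l j) = 0"
proof -
  \<comment> \<open>The transpose, so that a kernel vector is a relation between rows.\<close>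
  define A where "A = mat d d (\<lambda>(j, i). f i j)"
  have A: "A \<in> carrier_mat d d" by (simp add: A_def)
  have "Determinant.det A = Determinant.det (transpose_mat A)" using det_transpose[OF A] by simp
  also have "transpose_mat A = mat d d (\<lambda>(i, j). f i j)" by (rule eq_matI) (auto simp: A_def)
  finally have "Determinant.det A = 0" using assms by simp
  then obtain c where c: "c \<in> carrier_vec d" "c \<noteq> 0\<^sub>v d" "A *\<^sub>v c = 0\<^sub>v d"
    using det_0_iff_vec_prod_zero_field[OF A] by auto
  have "(\<Sum>l<d. c $ l * f l j) = 0" if "j < d" for j
  proof -
    have "(A *\<^sub>v c) $ j = (\<Sum>l<d. f l j * c $ l)"
      using that c(1) by (auto simp: A_def scalar_prod_def atLeast0LessThan intro!: sum.cong)
    then show ?thesis using c(3) that by (simp add: mult.commute)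
  qed
  moreover have "\<exists>l<d. c $ l \<noteq> 0"
    using c(1,2) by (metis carrier_vecD eq_vecI index_zero_vec(1) index_zero_vec(2))
  ultimately show ?thesis using that by blast
qed

section \<open>Independence of the node values\<close>

text \<open>One factor is divided out at a time; distinctness ensures that the quotient still
  vanishes at the remaining points.\<close>

lemma prod_linear_dvd:
  fixes V :: "'a::idom poly"
  assumes "distinct zs" and "\<And>z. z \<in> set zs \<Longrightarrow> poly V z = 0"
  shows "(\<Prod>z\<leftarrow>zs. [:- z, 1:]) dvd V"
  using assms
proof (induction zs arbitrary: V)
  case Nil
  then show ?case by simp
next
  case (Cons z zs)
  then have "poly V z = 0" by simp
  then obtain W where W: "V = [:- z, 1:] * W" by (auto simp: poly_eq_0_iff_dvd elim: dvdE)
  have "poly W u = 0" if "u \<in> set zs" for u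
  proof -
    have "u \<noteq> z" using that Cons.prems(1) by auto
    moreover have "poly V u = 0" using that Cons.prems(2) by simp
    ultimately show ?thesis by (simp add: W)
  qed
  then have "(\<Prod>z\<leftarrow>zs. [:- z, 1:]) dvd W" using Cons by simp
  then show ?case unfolding W by (simp only: list.map prod_list.Cons mult_dvd_mono dvd_refl)
qed

lemma prod_list_map_upt: "prod_list (map f [0..<n]) = (\<Prod>i<n. f i :: 'a::comm_monoid_mult)"
  by (induction n) simp_all

lemma degree_prod_linear: "degree (\<Prod>i<N. [:- f i, 1::'a::idom:]) = N"
  by (subst degree_prod_eq_sum_degree) auto

lemma monic_prod_linear: "lead_coeff (\<Prod>i<N. [:- f i, 1::'a::idom:]) = 1"
  by (simp add: lead_coeff_prod)

lemma even_odd_eval: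
  fixes F G :: "'a::comm_ring_1 poly"
  shows "poly (F \<circ>\<^sub>p [:0, 0, 1:] + [:0, 1:] * (G \<circ>\<^sub>p [:0, 0, 1:])) z = poly F (z\<^sup>2) + z * poly G (z\<^sup>2)"
  by (simp add: poly_pcompose power2_eq_square)

text \<open>With x = z^2 one has V1(z^2) + z V2(z^2) = P(-z) F(z). The hypotheses force V1 to vanish
  at the \<xi>_i^2 as well, so p(z^2) P(z) P(-z) divides this expression. Cancelling P(-z) makes
  \<open>F\<close> a multiple of p(z^2) P(z), whose degree 2M + N exceeds that of
  \<open>F\<close>.\<close>

lemma node_values_determine:
  fixes F1 F2 Pe Po P p :: "complex poly"
  assumes P: "P = Pe \<circ>\<^sub>p [:0, 0, 1:] + [:0, 1:] * (Po \<circ>\<^sub>p [:0, 0, 1:])"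
    and P_roots: "P = (\<Prod>i<N. [:- \<xi> i, 1:])" and p: "p = (\<Prod>i<M. [:- (r i)\<^sup>2, 1:])"
    and dist: "distinct (map (\<lambda>i. (r i)\<^sup>2) [0..<M] @ map (\<lambda>i. (\<xi> i)\<^sup>2) [0..<N])"
    and V1: "V1 = Pe * F1 - [:0, 1:] * Po * F2" and V2: "V2 = Pe * F2 - Po * F1"
    and r: "\<And>i. i < M \<Longrightarrow> poly V1 ((r i)\<^sup>2) = 0" "\<And>i. i < M \<Longrightarrow> poly V2 ((r i)\<^sup>2) = 0"
    and \<xi>2: "\<And>i. i < N \<Longrightarrow> poly V2 ((\<xi> i)\<^sup>2) = 0"
    and F: "F = F1 \<circ>\<^sub>p [:0, 0, 1:] + [:0, 1:] * (F2 \<circ>\<^sub>p [:0, 0, 1:])"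
    and deg: "degree F < 2 * M + N"
  shows "F = 0"
proof -
  let ?sq = "[:0, 0, 1::complex:]"
  note eval = even_odd_eval[of Pe Po, folded P] even_odd_eval[of F1 F2, folded F]
  have \<xi>1: "poly V1 ((\<xi> i)\<^sup>2) = 0" if "i < N" for i
  proof -
    \<comment> \<open>\<open>V\<^sub>1(z\<^sup>2) - z V\<^sub>2(z\<^sup>2) = P(z) (F\<^sub>1(z\<^sup>2) - z F\<^sub>2(z\<^sup>2))\<close>\<close>
    have "poly P (\<xi> i) = 0" using that by (auto simp: P_roots poly_prod)
    then have "(poly Pe ((\<xi> i)\<^sup>2) + \<xi> i * poly Po ((\<xi> i)\<^sup>2)) * (poly F1 ((\<xi> i)\<^sup>2) - \<xi> i * poly F2 ((\<xi> i)\<^sup>2)) = 0"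
      by (simp add: eval)
    then have "poly V1 ((\<xi> i)\<^sup>2) - \<xi> i * poly V2 ((\<xi> i)\<^sup>2) = 0"
      unfolding V1 V2 by (simp add: algebra_simps power2_eq_square)
    then show ?thesis using \<xi>2[OF that] by simp
  qed
  define D where "D = (\<Prod>z\<leftarrow>map (\<lambda>i. (r i)\<^sup>2) [0..<M] @ map (\<lambda>i. (\<xi> i)\<^sup>2) [0..<N]. [:- z, 1:])"
  have "D dvd V1" "D dvd V2"
    using r \<xi>1 \<xi>2 unfolding D_def by (auto intro!: prod_linear_dvd[OF dist] simp del: map_append)
  then obtain W1 W2 where W: "V1 = D * W1" "V2 = D * W2" by (auto elim!: dvdE)
  define W where "W = W1 \<circ>\<^sub>p ?sq + [:0, 1:] * (W2 \<circ>\<^sub>p ?sq)"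
  define Pm where "Pm = P \<circ>\<^sub>p [:0, -1:]"
  \<comment> \<open>Each factor z^2 - \<xi>^2 equals -(z - \<xi>)(-z - \<xi>), whence the sign
    (-1)^N.\<close>
  have D_eval: "poly D (z\<^sup>2) = (- 1) ^ N * poly p (z\<^sup>2) * poly P z * poly P (- z)" for z
  proof -
    have "(\<Prod>i<N. z\<^sup>2 - (\<xi> i)\<^sup>2) = (\<Prod>i<N. (- 1) * ((z - \<xi> i) * (- \<xi> i - z)))"
      by (rule prod.cong) (auto simp: power2_eq_square algebra_simps)
    also have "\<dots> = (- 1) ^ N * poly P z * poly P (- z)"
      by (simp only: prod.distrib P_roots poly_prod) (simp add: mult.assoc)
    finally show ?thesis
      by (simp add: D_def o_def prod_list_map_upt p poly_prod)
  qed
  have "Pm * F = Pm * (smult ((- 1) ^ N) (p \<circ>\<^sub>p ?sq) * P * W)"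
  proof (rule iffD1[OF poly_eq_poly_eq_iff], rule ext)
    fix z
    have "poly (Pm * F) z = poly V1 (z\<^sup>2) + z * poly V2 (z\<^sup>2)"
      by (simp add: Pm_def poly_pcompose eval V1 V2 algebra_simps power2_eq_square)
    also have "\<dots> = poly D (z\<^sup>2) * poly W z"
      by (simp add: W W_def poly_pcompose algebra_simps power2_eq_square)
    also have "\<dots> = poly (Pm * (smult ((- 1) ^ N) (p \<circ>\<^sub>p ?sq) * P * W)) z"
      by (simp add: D_eval[unfolded power2_eq_square] Pm_def poly_pcompose power2_eq_square mult_ac)
    finally show "poly (Pm * F) z = poly (Pm * (smult ((- 1) ^ N) (p \<circ>\<^sub>p ?sq) * P * W)) z" .
  qed
  moreover have P0: "P \<noteq> 0" "p \<noteq> 0" "degree P = N" "degree p = M"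
    using degree_prod_linear[of \<xi> N] degree_prod_linear[of "\<lambda>i. (r i)\<^sup>2" M]
      monic_prod_linear[of \<xi> N] monic_prod_linear[of "\<lambda>i. (r i)\<^sup>2" M] by (auto simp flip: P_roots p)
  then have "Pm \<noteq> 0" by (auto simp: Pm_def pcompose_eq_0_iff)
  ultimately have F_eq: "F = smult ((- 1) ^ N) (p \<circ>\<^sub>p ?sq) * P * W" by (simp only: mult_cancel_left) simp
  show "F = 0"
  proof (rule ccontr)
    assume "F \<noteq> 0"
    then have "W \<noteq> 0" "p \<circ>\<^sub>p ?sq \<noteq> 0" using F_eq by auto
    then have "degree F = 2 * M + N + degree W"
      unfolding F_eq using P0 by (simp add: degree_mult_eq degree_pcompose)
    then show False using deg by simp
  qed
qed

text \<open>The relation concerns the values of the combinations \<open>Fp a\<close> of the A_a^(l).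
  Since X_1(z^2) + z X_2(z^2) lists the powers of z, \<open>Fp 1\<close> and \<open>Fp 2\<close> are
  the even and odd parts of one polynomial \<open>F\<close> of degree below \<open>d\<close>, to
  which \<open>node_values_determine\<close> applies.\<close>

lemma typeI_node_independence:
  assumes T: "lower_unitriangular T" and H: "\<forall>n. H n \<noteq> 0"
    and P: "cpoly P = cpoly Pe \<circ>\<^sub>p [:0, 0, 1:] + [:0, 1:] * (cpoly Po \<circ>\<^sub>p [:0, 0, 1:])"
    and P_roots: "cpoly P = (\<Prod>i<N. [:- \<xi> i, 1:])" and p: "cpoly p = (\<Prod>i<M. [:- (r i)\<^sup>2, 1:])"
    and dist: "distinct (map (\<lambda>i. (r i)\<^sup>2) [0..<M] @ map (\<lambda>i. (\<xi> i)\<^sup>2) [0..<N])"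
    and d: "d = 2 * M + N"
    and zero: "\<And>j. j < d \<Longrightarrow> (\<Sum>l<d. c l * node_row M N r \<xi> (mixed Pe Po (\<lambda>a. typeI_poly H T a l)) ! j) = 0"
    and "l < d"
  shows "c l = 0"
proof (rule ccontr)
  assume "c l \<noteq> 0"
  \<comment> \<open>\<open>split_monomials\<close> is evaluated at the polynomial variable, which
    turns the entries of X_a into polynomials.\<close>
  define X where "X a i = split_monomials a [:0, 1::complex:] i" for a i
  define Fp where "Fp a = (\<Sum>l<d. smult (c l * inverse (of_real (H l))) (\<Sum>i\<le>l. smult (of_real (T l i)) (X a i)))" for a
  have X: "poly (X a i) y = split_monomials a y i" for a i y
    by (simp add: X_def split_monomials_def)
  have Fp: "poly (Fp a) y = (\<Sum>l<d. c l * typeI_poly H T a l y)" for a y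
    by (simp add: Fp_def poly_sum typeI_poly_def X mult.assoc)
  define F where "F = (\<Sum>l<d. smult (c l * inverse (of_real (H l))) (\<Sum>i\<le>l. monom (of_real (T l i)) i))"
  have F_eq: "F = Fp 1 \<circ>\<^sub>p [:0, 0, 1:] + [:0, 1:] * (Fp 2 \<circ>\<^sub>p [:0, 0, 1:])"
  proof (rule iffD1[OF poly_eq_poly_eq_iff], rule ext)
    fix z :: complex
    have *: "split_monomials 1 (z\<^sup>2) i + z * split_monomials 2 (z\<^sup>2) i = z ^ i" for i
      by (auto simp: split_monomials_def simp flip: power_mult elim!: evenE oddE)
    have "poly F z = (\<Sum>l<d. c l * inverse (of_real (H l)) * (\<Sum>i\<le>l. of_real (T l i)
        * (split_monomials 1 (z\<^sup>2) i + z * split_monomials 2 (z\<^sup>2) i)))"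
      by (simp only: *) (simp add: F_def poly_sum poly_monom)
    also have "\<dots> = poly (Fp 1) (z\<^sup>2) + z * poly (Fp 2) (z\<^sup>2)"
      by (simp add: Fp_def poly_sum X sum.distrib sum_distrib_left algebra_simps)
    finally show "poly F z = poly (Fp 1 \<circ>\<^sub>p [:0, 0, 1:] + [:0, 1:] * (Fp 2 \<circ>\<^sub>p [:0, 0, 1:])) z"
      by (simp only: even_odd_eval)
  qed
  have coeff_F: "coeff F j = (\<Sum>l<d. c l * inverse (of_real (H l)) * of_real (T l j))" for j
  proof -
    have "(\<Sum>i\<le>l. coeff (monom (complex_of_real (T l i)) i) j) = of_real (T l j)" for l
    proof -
      have "(\<Sum>i\<le>l. coeff (monom (complex_of_real (T l i)) i) j) = (\<Sum>i\<le>l. if i = j then of_real (T l j) else 0)"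
        by (rule sum.cong) auto
      then show ?thesis using T by (auto simp: lower_unitriangular_def)
    qed
    then show ?thesis by (simp add: F_def coeff_sum)
  qed
  have "degree F < d"
  proof -
    have "degree F \<le> d - 1"
      by (rule degree_le) (use T in \<open>auto simp: coeff_F lower_unitriangular_def intro!: sum.neutral\<close>)
    then show ?thesis using \<open>l < d\<close> by simp
  qed
  have val: "(\<Sum>l<d. c l * mixed Pe Po (\<lambda>a. typeI_poly H T a l) a y)
      = poly (if a = 1 then cpoly Pe * Fp 1 - [:0, 1:] * cpoly Po * Fp 2
          else cpoly Pe * Fp 2 - cpoly Po * Fp 1) y" for a y
    by (simp add: mixed_def Fp sum_distrib_left sum_subtractf sum.distrib sum_negf algebra_simps)
  have "F = 0"
  proof (rule node_values_determine[OF P P_roots p dist refl refl _ _ _ F_eq])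
    show "degree F < 2 * M + N" using \<open>degree F < d\<close> d by simp
    \<comment> \<open>The three blocks of a node row start at the columns 0, M and 2M.\<close>
    show "poly (cpoly Pe * Fp 1 - [:0, 1:] * cpoly Po * Fp 2) ((r i)\<^sup>2) = 0" if "i < M" for i
      using zero[of i] val[of 1 "(r i)\<^sup>2"] that d by (simp add: node_row_def nth_append)
    show "poly (cpoly Pe * Fp 2 - cpoly Po * Fp 1) ((r i)\<^sup>2) = 0" if "i < M" for i
      using zero[of "M + i"] val[of 2 "(r i)\<^sup>2"] that d by (simp add: node_row_def nth_append)
    show "poly (cpoly Pe * Fp 2 - cpoly Po * Fp 1) ((\<xi> i)\<^sup>2) = 0" if "i < N" for i
      using zero[of "2 * M + i"] val[of 2 "(\<xi> i)\<^sup>2"] that d by (simp add: node_row_def nth_append)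
  qed
  \<comment> \<open>In the coefficient of z^m, \<open>T\<close> vanishes for l < m and
    \<open>c\<close> for l > m, so it equals c_m / H_m, which contradicts F = 0.\<close>
  define m where "m = Max {l. l < d \<and> c l \<noteq> 0}"
  have fin: "finite {l. l < d \<and> c l \<noteq> 0}" by simp
  have m: "m < d" "c m \<noteq> 0" and max: "\<And>l. l < d \<Longrightarrow> m < l \<Longrightarrow> c l = 0"
    using Max_in[OF fin] Max_ge[OF fin] \<open>c l \<noteq> 0\<close> \<open>l < d\<close> unfolding m_def[symmetric]
    by (blast, blast, fastforce dest: leD)
  have "coeff F m = (\<Sum>l<d. if l = m then c m * inverse (of_real (H m)) else 0)"
    unfolding coeff_F
  proof (rule sum.cong)
    fix l assume "l \<in> {..<d}"
    then show "c l * inverse (of_real (H l)) * of_real (T l m)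
        = (if l = m then c m * inverse (of_real (H m)) else 0)"
      using T max[of l] by (cases l m rule: linorder_cases) (auto simp: lower_unitriangular_def)
  qed simp
  then show False using m H \<open>F = 0\<close> by simp
qed

section \<open>The Christoffel formulas\<close>

lemma cpoly_add: "cpoly (F + G) = cpoly F + cpoly G"
  by (rule poly_eqI) (simp add: coeff_map_poly)

lemma cpoly_diff: "cpoly (F - G) = cpoly F - cpoly G"
  by (rule poly_eqI) (simp add: coeff_map_poly)

lemma cpoly_mult: "cpoly (F * G) = cpoly F * cpoly G"
  by (rule poly_eqI) (simp add: coeff_map_poly coeff_mult)

lemma cpoly_pcompose: "cpoly (F \<circ>\<^sub>p G) = cpoly F \<circ>\<^sub>p cpoly G"
  by (induction F) (simp_all add: pcompose_pCons map_poly_pCons cpoly_add cpoly_mult)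

lemma monic_cpoly_prod:
  assumes "cpoly P = (\<Prod>i<N. [:- \<xi> i, 1:])"
  shows "degree P = N" and "lead_coeff P = 1"
proof -
  have "degree (cpoly P) = degree P" by (rule degree_map_poly) simp
  then show "degree P = N" using degree_prod_linear[of \<xi> N] assms by simp
  have "complex_of_real (lead_coeff P) = lead_coeff (cpoly P)"
    using \<open>degree (cpoly P) = degree P\<close> by (simp add: coeff_map_poly)
  also have "\<dots> = 1" unfolding assms by (rule monic_prod_linear)
  finally show "lead_coeff P = 1" by simp
qed

lemma mixed_sum:
  "mixed Pe Po (\<lambda>a y. \<Sum>l\<in>L. c l * f l a y) a y = (\<Sum>l\<in>L. c l * mixed Pe Po (f l) a y)"
  by (simp add: mixed_def sum_distrib_left sum_negf sum.distrib sum_subtractf algebra_simps)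

lemma node_row_nth:
  assumes "j < 2 * M + N"
  shows "node_row M N r \<xi> f ! j = f (if j < M then 1 else 2)
    (if j < M then (r j)\<^sup>2 else if j < 2 * M then (r (j - M))\<^sup>2 else (\<xi> (j - 2 * M))\<^sup>2)"
  using assms by (auto simp: node_row_def nth_append mult_2)

lemma length_node_row [simp]: "length (node_row M N r \<xi> f) = 2 * M + N"
  by (simp add: node_row_def)

lemma poly_cpoly_pi:
  "poly (cpoly (Pe\<^sup>2 - [:0, 1:] * Po\<^sup>2)) y = (poly (cpoly Pe) y)\<^sup>2 - y * (poly (cpoly Po) y)\<^sup>2"
  by (simp add: cpoly_diff cpoly_mult power2_eq_square map_poly_pCons)

text \<open>\<open>Q\<close> has even part p Pe and odd part p Po. Hence \<open>\<Omega>\<close>^t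
  takes (A_1, A_2) to p times the matrix with rows (Pe, y Po), (Po, Pe) applied to (A'_1, A'_2).
  \<open>mixed\<close> applies the adjugate of this matrix, leaving its determinant Pe^2 - y
  Po^2.\<close>

lemma christoffel_mixed:
  assumes gb: "gauss_borel (moment_matrix \<mu> \<Delta> w1 w2) S H T"
    and gb': "gauss_borel (moment_matrix \<mu> \<Delta> (\<lambda>x. poly p x * (poly Pe x * w1 x + poly Po x * w2 x))
      (\<lambda>x. poly p x * (x * poly Po x * w1 x + poly Pe x * w2 x))) S' H' T'"
    and i1: "\<And>j. set_integrable \<mu> \<Delta> (\<lambda>x. x ^ j * w1 x)"
    and i2: "\<And>j. set_integrable \<mu> \<Delta> (\<lambda>x. x ^ j * w2 x)"
    and P: "P = Pe \<circ>\<^sub>p [:0, 0, 1:] + [:0, 1:] * (Po \<circ>\<^sub>p [:0, 0, 1:])"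
    and monic: "lead_coeff P = 1" "lead_coeff p = 1"
    and d: "d = 2 * degree p + degree P"
  obtains \<Omega> :: "nat \<Rightarrow> nat \<Rightarrow> real" where "lower_unitriangular \<Omega>" "\<And>m. \<Omega> (m + d) m \<noteq> 0"
    "\<And>l m. m + d < l \<Longrightarrow> \<Omega> l m = 0"
    "\<And>n x. typeII_poly S n x = (\<Sum>m\<le>n. of_real (\<Omega> n m) * typeII_poly S' m x)"
    "\<And>m a y. a \<in> {1, 2} \<Longrightarrow> (\<Sum>l\<le>m + d. of_real (\<Omega> l m) * mixed Pe Po (\<lambda>a. typeI_poly H T a l) a y)
      = poly (cpoly p) y * poly (cpoly (Pe\<^sup>2 - [:0, 1:] * Po\<^sup>2)) y * typeI_poly H' T' a m y"
proof -
  define Q where "Q = (p \<circ>\<^sub>p [:0, 0, 1:]) * P"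
  have Q: "Q = (p * Pe) \<circ>\<^sub>p [:0, 0, 1:] + [:0, 1:] * ((p * Po) \<circ>\<^sub>p [:0, 0, 1:])"
    by (simp only: Q_def P pcompose_mult algebra_simps)
  have nz: "p \<circ>\<^sub>p [:0, 0, 1:] \<noteq> 0" "P \<noteq> 0" using monic by (auto simp: pcompose_eq_0_iff)
  then have deg: "degree Q = d" by (simp add: Q_def d degree_mult_eq degree_pcompose)
  have "lead_coeff Q = 1"
    using lead_coeff_comp[of "[:0, 0, 1::real:]" p] monic by (simp add: Q_def lead_coeff_mult)
  then have qd: "coeff Q d \<noteq> 0" by (simp add: deg)
  have mm: "moment_matrix \<mu> \<Delta> (\<lambda>x. poly p x * (poly Pe x * w1 x + poly Po x * w2 x))
      (\<lambda>x. poly p x * (x * poly Po x * w1 x + poly Pe x * w2 x)) i j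
    = (\<Sum>k\<le>d. coeff Q k * moment_matrix \<mu> \<Delta> w1 w2 i (j + k))" for i j
    using moment_matrix_christoffel[OF Q _ i1 i2, of d i j] deg
    by (simp add: algebra_simps)
  show ?thesis
  proof (rule christoffel_connection[OF gb gb' mm qd])
    fix \<Omega> :: "nat \<Rightarrow> nat \<Rightarrow> real"
    assume \<Omega>: "lower_unitriangular \<Omega>" "\<And>m. \<Omega> (m + d) m \<noteq> 0"
      "\<And>l m. m + d < l \<Longrightarrow> \<Omega> l m = 0"
      "\<And>n x. typeII_poly S n x = (\<Sum>m\<le>n. of_real (\<Omega> n m) * typeII_poly S' m x)"
      and A: "\<And>m a x. (\<Sum>l\<le>m + d. of_real (\<Omega> l m) * typeI_poly H T a l x)
        = inverse (of_real (H' m))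
          * (\<Sum>j\<le>m. of_real (T' m j) * (\<Sum>k\<le>d. of_real (coeff Q k) * split_monomials a x (j + k)))"
    have A12: "(\<Sum>l\<le>m + d. of_real (\<Omega> l m) * typeI_poly H T 1 l y)
        = poly (cpoly p) y * (poly (cpoly Pe) y * typeI_poly H' T' 1 m y
          + y * poly (cpoly Po) y * typeI_poly H' T' 2 m y)"
      "(\<Sum>l\<le>m + d. of_real (\<Omega> l m) * typeI_poly H T 2 l y)
        = poly (cpoly p) y * (poly (cpoly Po) y * typeI_poly H' T' 1 m y
          + poly (cpoly Pe) y * typeI_poly H' T' 2 m y)" for m y
      unfolding A split_monomials_shift[OF Q eq_refl[OF deg], where ?'a = complex]
      by (simp_all add: typeI_poly_def cpoly_mult sum_distrib_left sum.distrib
          algebra_simps)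
    have "(\<Sum>l\<le>m + d. of_real (\<Omega> l m) * mixed Pe Po (\<lambda>a. typeI_poly H T a l) a y)
        = poly (cpoly p) y * poly (cpoly (Pe\<^sup>2 - [:0, 1:] * Po\<^sup>2)) y * typeI_poly H' T' a m y"
      if a: "a \<in> {1, 2}" for m a y
    proof -
      have eq: "(\<Sum>l\<le>m + d. of_real (\<Omega> l m) * mixed Pe Po (\<lambda>a. typeI_poly H T a l) a y)
        = mixed Pe Po (\<lambda>a y. \<Sum>l\<le>m + d. of_real (\<Omega> l m) * typeI_poly H T a l y) a y"
        by (rule mixed_sum[symmetric])
      consider "a = 1" | "a = 2" using a by blast
      then show ?thesis
      proof cases
        case 1
        show ?thesis
          unfolding eq unfolding mixed_def 1 A12 poly_cpoly_pi
          by (simp add: power2_eq_square algebra_simps)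
      next
        case 2
        show ?thesis
          unfolding eq unfolding mixed_def 2 A12 poly_cpoly_pi
          by (simp add: power2_eq_square algebra_simps)
      qed
    qed
    from that[OF \<Omega> this] show thesis .
  qed
qed

theorem theorem11:
  fixes \<Delta> :: "real set" and \<mu> :: "real measure" and w1 w2 :: "real \<Rightarrow> real"
    and M N :: nat and r \<xi> :: "nat \<Rightarrow> complex" and p P Pe Po :: "real poly"
    and S T S' T' :: "nat \<Rightarrow> nat \<Rightarrow> real" and H H' :: "nat \<Rightarrow> real" and n d :: nat
    and w1' w2' :: "real \<Rightarrow> real" and \<pi> :: "real poly"
    and v :: "nat \<Rightarrow> nat \<Rightarrow> complex \<Rightarrow> complex"
    and k :: "nat \<Rightarrow> complex \<Rightarrow> nat \<Rightarrow> complex \<Rightarrow> complex"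
    and R :: "nat \<Rightarrow> complex list" and \<tau> :: "nat \<Rightarrow> complex"
  defines "w1' \<equiv> \<lambda>x. poly p x * (poly Pe x * w1 x + poly Po x * w2 x)"
    and "w2' \<equiv> \<lambda>x. poly p x * (x * poly Po x * w1 x + poly Pe x * w2 x)"
    and "\<pi> \<equiv> Pe\<^sup>2 - [:0, 1:] * Po\<^sup>2"
    and "d \<equiv> 2 * M + N"
    and "v \<equiv> \<lambda>l. mixed Pe Po (\<lambda>a. typeI_poly H T a l)"
    and "k \<equiv> \<lambda>l x. mixed Pe Po (\<lambda>a. cd_kernel S H T a l x)"
    and "R \<equiv> \<lambda>l. node_row M N r \<xi> (v l)"
    and "\<tau> \<equiv> \<lambda>l. rows_det d (map R [l..<l + d])"
  assumes "is_interval \<Delta>" and "sets \<mu> = sets borel" and "emeasure \<mu> (- \<Delta>) = 0"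
    and "\<And>j. set_integrable \<mu> \<Delta> (\<lambda>x. x ^ j * w1 x)"
    and "\<And>j. set_integrable \<mu> \<Delta> (\<lambda>x. x ^ j * w2 x)"
    and "cpoly P = (\<Prod>i<N. [:- \<xi> i, 1:])"
    and "\<And>z. z \<noteq> 0 \<Longrightarrow> poly (cpoly P) z = 0 \<Longrightarrow> poly (cpoly P) (- z) \<noteq> 0"
    and "cpoly p = (\<Prod>i<M. [:- (r i)\<^sup>2, 1:])"
    and "P = Pe \<circ>\<^sub>p [:0, 0, 1:] + [:0, 1:] * (Po \<circ>\<^sub>p [:0, 0, 1:])"
    and "distinct (map (\<lambda>i. (r i)\<^sup>2) [0..<M] @ map (\<lambda>i. (\<xi> i)\<^sup>2) [0..<N])"
    and "gauss_borel (moment_matrix \<mu> \<Delta> w1 w2) S H T"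
    and "gauss_borel (moment_matrix \<mu> \<Delta> w1' w2') S' H' T'"
    and "d \<ge> 1" and "n \<ge> d"
  shows "\<tau> (n + 1) \<noteq> 0 \<and> \<tau> (n - 1) \<noteq> 0
    \<and> (\<forall>a\<in>{1, 2}. \<forall>y. poly (cpoly \<pi>) y \<noteq> 0 \<longrightarrow> poly (cpoly p) y \<noteq> 0 \<longrightarrow>
         typeI_poly H' T' a n y =
           (- 1) ^ d / (\<tau> (n + 1) * poly (cpoly \<pi>) y * poly (cpoly p) y)
             * rows_det (d + 1) (map (\<lambda>l. R l @ [v l a y]) [n..<n + d + 1]))
    \<and> (\<forall>x. typeII_poly S' (n - 1) x =
           1 / \<tau> (n - 1) * rows_det d (node_row M N r \<xi> (k n x) # map R [n..<n + d - 1]))"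
proof -
  note nodes = \<open>cpoly P = (\<Prod>i<N. [:- \<xi> i, 1:])\<close> \<open>cpoly p = (\<Prod>i<M. [:- (r i)\<^sup>2, 1:])\<close>
    \<open>distinct (map (\<lambda>i. (r i)\<^sup>2) [0..<M] @ map (\<lambda>i. (\<xi> i)\<^sup>2) [0..<N])\<close>
  note P = \<open>P = Pe \<circ>\<^sub>p [:0, 0, 1:] + [:0, 1:] * (Po \<circ>\<^sub>p [:0, 0, 1:])\<close>
  note gb = \<open>gauss_borel (moment_matrix \<mu> \<Delta> w1 w2) S H T\<close>
  have cP: "cpoly P = cpoly Pe \<circ>\<^sub>p [:0, 0, 1:] + [:0, 1:] * (cpoly Po \<circ>\<^sub>p [:0, 0, 1:])"
    unfolding P by (simp only: cpoly_add cpoly_mult cpoly_pcompose) (simp add: map_poly_pCons)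
  have d_eq: "d = 2 * degree p + degree P"
    using monic_cpoly_prod(1)[OF nodes(1)] monic_cpoly_prod(1)[OF nodes(2)] by (simp add: d_def)
  obtain \<Omega> :: "nat \<Rightarrow> nat \<Rightarrow> real" where \<Omega>: "lower_unitriangular \<Omega>" "\<forall>m. \<Omega> (m + d) m \<noteq> 0"
    and \<Omega>_band: "\<forall>l m. m + d < l \<longrightarrow> \<Omega> l m = 0"
    and typeII: "\<forall>n x. typeII_poly S n x = (\<Sum>m\<le>n. of_real (\<Omega> n m) * typeII_poly S' m x)"
    and \<Omega>_v: "\<forall>m a y. a \<in> {1, 2} \<longrightarrow> (\<Sum>l\<le>m + d. of_real (\<Omega> l m) * v l a y)
      = poly (cpoly p) y * poly (cpoly \<pi>) y * typeI_poly H' T' a m y"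
  proof (rule christoffel_mixed[OF gb _ _ _ P _ _ d_eq])
    show "gauss_borel (moment_matrix \<mu> \<Delta> (\<lambda>x. poly p x * (poly Pe x * w1 x + poly Po x * w2 x))
        (\<lambda>x. poly p x * (x * poly Po x * w1 x + poly Pe x * w2 x))) S' H' T'"
      using \<open>gauss_borel (moment_matrix \<mu> \<Delta> w1' w2') S' H' T'\<close> unfolding w1'_def w2'_def .
    show "lead_coeff P = 1" "lead_coeff p = 1"
      by (rule monic_cpoly_prod(2)[OF nodes(1)], rule monic_cpoly_prod(2)[OF nodes(2)])
  qed (use assms(12,13) that in \<open>auto simp: v_def \<pi>_def\<close>)
  define \<omega> where "\<omega> l m = complex_of_real (\<Omega> l m)" for l m
  have \<omega>_lower: "\<omega> l l = 1" "l < m \<Longrightarrow> \<omega> l m = 0" for l m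
    using \<Omega>(1) by (auto simp: \<omega>_def lower_unitriangular_def)
  have \<omega>_corner: "\<omega> (m + d) m \<noteq> 0" for m using \<Omega>(2) by (simp add: \<omega>_def)
  \<comment> \<open>By triangularity the rows before \<open>m\<close> contribute nothing to column
    \<open>m\<close>.\<close>
  have \<omega>_sum: "(\<Sum>i<Suc d. \<omega> (m + i) m * f (m + i)) = (\<Sum>l\<le>m + d. \<omega> l m * f l)" for m f
  proof -
    have "(\<Sum>i<Suc d. \<omega> (m + i) m * f (m + i)) = (\<Sum>l\<in>{m..m + d}. \<omega> l m * f l)"
      by (rule sum.reindex_bij_witness[of _ "\<lambda>l. l - m" "\<lambda>i. m + i"]) auto
    also have "\<dots> = (\<Sum>l\<le>m + d. \<omega> l m * f l)"
      by (rule sum.mono_neutral_left) (auto simp: \<omega>_lower)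
    finally show ?thesis .
  qed
  have \<omega>_v: "(\<Sum>i<Suc d. \<omega> (m + i) m * v (m + i) a y)
      = poly (cpoly p) y * poly (cpoly \<pi>) y * typeI_poly H' T' a m y" if "a \<in> {1, 2}" for m a y
    unfolding \<omega>_sum[of m "\<lambda>l. v l a y"] using \<Omega>_v that by (simp only: \<omega>_def)

  \<comment> \<open>\<open>na j\<close> and \<open>nz j\<close> are the component and the node
    belonging to column \<open>j\<close> of a node row.\<close>
  define na :: "nat \<Rightarrow> nat" where "na j = (if j < M then 1 else 2)" for j
  define nz where "nz j = (if j < M then (r j)\<^sup>2 else if j < 2 * M then (r (j - M))\<^sup>2
    else (\<xi> (j - 2 * M))\<^sup>2)" for j
  have na: "na j \<in> {1, 2}" for j by (simp add: na_def)
  have row: "node_row M N r \<xi> f ! j = f (na j) (nz j)" if "j < d" for f j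
    using that by (simp add: node_row_nth d_def na_def nz_def)
  have len: "length (R l) = d" for l by (simp add: R_def d_def)
  \<comment> \<open>\<open>p\<close> vanishes at the r_i^2, and \<pi>(z^2) = P(z) P(-z) vanishes at
    z = \<xi>_i, so the right-hand side of \<open>\<omega>_v\<close> is zero at every node.\<close>
  have node_zero: "poly (cpoly p) (nz j) * poly (cpoly \<pi>) (nz j) = 0" if "j < d" for j
  proof (cases "j < 2 * M")
    case True
    then have "nz j \<in> (\<lambda>i. (r i)\<^sup>2) ` {..<M}" by (auto simp: nz_def)
    then show ?thesis by (auto simp: nodes(2) poly_prod)
  next
    case False
    define z where "z = \<xi> (j - 2 * M)"
    have "j - 2 * M < N" using False that by (simp add: d_def)
    then have "poly (cpoly P) z = 0" by (auto simp: nodes(1) poly_prod z_def)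
    moreover have "poly (cpoly \<pi>) (z\<^sup>2) = poly (cpoly P) z * (poly (cpoly Pe) (z\<^sup>2) - z * poly (cpoly Po) (z\<^sup>2))"
      unfolding \<pi>_def poly_cpoly_pi cP even_odd_eval by (simp add: power2_eq_square algebra_simps)
    ultimately show ?thesis using False by (simp add: nz_def z_def)
  qed
  have \<omega>_R: "(\<Sum>i<Suc d. \<omega> (m + i) m * R (m + i) ! j) = 0" if "j < d" for m j
    using \<omega>_v[OF na, of m j "nz j"] node_zero[OF that] row[OF that] by (simp add: R_def)

  obtain e where e: "d = Suc e" using \<open>d \<ge> 1\<close> by (cases d) auto
  have \<tau>_det: "\<tau> m = Determinant.det (mat d d (\<lambda>(i, j). R (m + i) ! j))" for m
    unfolding \<tau>_def by (rule rows_det_map_upt)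
  \<comment> \<open>As \<open>\<omega> m m = 1\<close>, the relation \<open>\<omega>_R\<close>
    expresses R_m by the next \<open>d\<close> rows. The minus sign of the coefficients turns (-1)^e
    into (-1)^d.\<close>
  have \<tau>_step: "\<tau> m = (- 1) ^ d * \<omega> (m + d) m * \<tau> (Suc m)" for m
  proof -
    have "R m ! j = (\<Sum>l<Suc e. - \<omega> (Suc m + l) m * R (Suc m + l) ! j)" if "j < Suc e" for j
      using \<omega>_R[of j m] that unfolding sum.lessThan_Suc_shift[of _ d]
      by (simp add: e \<omega>_lower sum_negf eq_neg_iff_add_eq_0 del: sum.lessThan_Suc)
    from det_Cons_combination[OF this]
    have "rows_det (Suc e) (R m # map R [Suc m..<Suc m + e])
        = (- 1) ^ e * - \<omega> (Suc m + e) m * \<tau> (Suc m)"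
      unfolding rows_det_Cons_map_upt \<tau>_det e .
    moreover have "map R [m..<m + d] = R m # map R [Suc m..<Suc m + e]"
      by (simp add: e upt_conv_Cons del: upt_Suc)
    ultimately show ?thesis by (simp add: \<tau>_def e)
  qed
  \<comment> \<open>Independence of the first \<open>d\<close> rows gives the base case; then
    \<open>\<tau>_step\<close> carries nonvanishing upwards, since \<tau>_(m+1) is a factor of
    \<tau>_m.\<close>
  have \<tau>_nz: "\<tau> m \<noteq> 0" for m
  proof (induction m)
    case 0
    show ?case
    proof
      assume "\<tau> 0 = 0"
      then have "Determinant.det (mat d d (\<lambda>(i, j). R i ! j)) = 0" by (simp add: \<tau>_det)
      then obtain c where c: "\<exists>l<d. c l \<noteq> 0" "\<forall>j<d. (\<Sum>l<d. c l * R l ! j) = 0"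
        by (rule det_eq_0_imp_row_combination)
      have "lower_unitriangular T" "\<forall>n. H n \<noteq> 0" using gb by (auto simp: gauss_borel_def)
      from typeI_node_independence[OF this cP nodes d_def[THEN meta_eq_to_obj_eq] c(2)[rule_format, unfolded R_def v_def]] c(1)
      show False by blast
    qed
  next
    case (Suc m)
    then show ?case using \<tau>_step[of m] by auto
  qed

  \<comment> \<open>The weights \<open>\<omega> (n + i) n\<close> annihilate the columns of the R_l
    and leave p \<pi> A'_a in the last one. The factor (-1)^d is the cofactor sign of row 0 and
    column d; the complementary minor has rows R_(n+1), ..., R_(n+d) and is \<tau>_(n+1).\<close>
  have first: "typeI_poly H' T' a n y = (- 1) ^ d / (\<tau> (n + 1) * poly (cpoly \<pi>) y * poly (cpoly p) y)
      * rows_det (d + 1) (map (\<lambda>l. R l @ [v l a y]) [n..<n + d + 1])"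
    if a: "a \<in> {1, 2}" and nz: "poly (cpoly \<pi>) y \<noteq> 0" "poly (cpoly p) y \<noteq> 0" for a y
  proof -
    let ?s = "poly (cpoly p) y * poly (cpoly \<pi>) y * typeI_poly H' T' a n y"
    let ?f = "\<lambda>i j. (R (n + i) @ [v (n + i) a y]) ! j"
    have comb: "(\<Sum>i<Suc d. \<omega> (n + i) n * ?f i j) = (if j = d then ?s else 0)" if "j < Suc d" for j
      using that \<omega>_v[OF a, of n y] \<omega>_R[of j n]
      by (simp add: nth_append len del: sum.lessThan_Suc)
    have "Determinant.det (mat (Suc d) (Suc d) (\<lambda>(i, j). ?f i j))
        = (- 1) ^ d * ?s * Determinant.det (mat d d (\<lambda>(i, j). ?f (Suc i) j))"
      by (rule det_row_combination_unit[where c = "\<lambda>i. \<omega> (n + i) n", OF _ comb]) (simp_all add: \<omega>_lower)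
    also have "mat d d (\<lambda>(i, j). ?f (Suc i) j) = mat d d (\<lambda>(i, j). R (n + 1 + i) ! j)"
      by (rule eq_matI) (auto simp: nth_append len)
    finally have "rows_det (d + 1) (map (\<lambda>l. R l @ [v l a y]) [n..<n + d + 1])
        = (- 1) ^ d * ?s * \<tau> (n + 1)"
      using rows_det_map_upt[of "Suc d" "\<lambda>l. R l @ [v l a y]" n] by (simp add: \<tau>_det)
    then show ?thesis
      using nz \<tau>_nz[of "n + 1"] by (simp add: field_simps flip: power_mult_distrib)
  qed

  have second: "typeII_poly S' (n - 1) x
      = 1 / \<tau> (n - 1) * rows_det d (node_row M N r \<xi> (k n x) # map R [n..<n + d - 1])" for x
  proof -
    let ?B = "\<lambda>m. typeII_poly S' m x"
    \<comment> \<open>Inserting B = \<open>\<Omega>\<close> B' into the kernel gives, for each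
      column of \<open>\<Omega>\<close>, its sum over l < n against the R_l. The full column sum is
      zero, so this head is minus the tail l = n, ..., n + d - 1, which yields
      \<open>c\<close>.\<close>
    define c where "c l = - (\<Sum>m<n. \<omega> (n + l) m * ?B m)" for l
    \<comment> \<open>Here n >= d >= 1, so n - 1 is not truncated.\<close>
    have n: "n = Suc (n - 1)" using \<open>d \<ge> 1\<close> \<open>n \<ge> d\<close> by simp
    have k_eq: "k n x a y = (\<Sum>m<n. typeII_poly S m x * v m a y)" for a y
      unfolding k_def v_def cd_kernel_def by (rule mixed_sum)
    have "node_row M N r \<xi> (k n x) ! j = (\<Sum>l<Suc e. c l * R (n + l) ! j)" if "j < Suc e" for j
    proof -
      have j: "j < d" using that e by simp
      define V where "V l = R l ! j" for l
      \<comment> \<open>Column \<open>m\<close> of \<open>\<Omega>\<close> ends at row m + d < n +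
        d, so the sum contains it entirely.\<close>
      have band: "(\<Sum>l<n + d. \<omega> l m * V l) = 0" if "m < n" for m
      proof -
        have "(\<Sum>l<n + d. \<omega> l m * V l) = (\<Sum>l\<le>m + d. \<omega> l m * V l)"
          by (rule sum.mono_neutral_right) (use that \<Omega>_band in \<open>auto simp: \<omega>_def\<close>)
        also have "\<dots> = (\<Sum>i<Suc d. \<omega> (m + i) m * V (m + i))" by (rule \<omega>_sum[symmetric])
        finally show ?thesis using \<omega>_R[OF j, of m] by (simp add: V_def)
      qed
      have "0 = (\<Sum>m<n. ?B m * (\<Sum>l<n + d. \<omega> l m * V l))" by (simp add: band)
      also have "\<dots> = (\<Sum>l<n + d. (\<Sum>m<n. \<omega> l m * ?B m) * V l)"
        unfolding sum_distrib_left sum_distrib_right by (subst sum.swap) (simp add: mult_ac)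
      also have "\<dots> = (\<Sum>l<n. (\<Sum>m<n. \<omega> l m * ?B m) * V l) + (\<Sum>l<d. (\<Sum>m<n. \<omega> (n + l) m * ?B m) * V (n + l))"
        by (induction d) (simp_all add: algebra_simps)
      also have "(\<Sum>l<n. (\<Sum>m<n. \<omega> l m * ?B m) * V l) = (\<Sum>l<n. typeII_poly S l x * V l)"
      proof (rule sum.cong)
        fix l assume "l \<in> {..<n}"
        then have "(\<Sum>m<n. \<omega> l m * ?B m) = (\<Sum>m\<le>l. \<omega> l m * ?B m)"
          by (intro sum.mono_neutral_right) (auto simp: \<omega>_lower)
        then show "(\<Sum>m<n. \<omega> l m * ?B m) * V l = typeII_poly S l x * V l"
          using typeII by (simp add: \<omega>_def)
      qed simp
      also have "\<dots> = k n x (na j) (nz j)"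
        using row[OF j] by (simp add: k_eq V_def R_def)
      finally show ?thesis
        using row[OF j] by (simp add: c_def V_def e sum_negf eq_neg_iff_add_eq_0 del: sum.lessThan_Suc)
    qed
    from det_Cons_combination[OF this]
    have "rows_det (Suc e) (node_row M N r \<xi> (k n x) # map R [n..<n + e]) = (- 1) ^ e * c e * \<tau> n"
      unfolding rows_det_Cons_map_upt \<tau>_det e .
    \<comment> \<open>Row n + e = (n - 1) + d meets the band, among the columns m < n, only at m = n
      - 1.\<close>
    moreover have "c e = - \<omega> (n - 1 + d) (n - 1) * ?B (n - 1)"
    proof -
      have "(\<Sum>m<n. \<omega> (n + e) m * ?B m) = (\<Sum>m\<in>{n - 1}. \<omega> (n + e) m * ?B m)"
        by (rule sum.mono_neutral_right) (use n \<Omega>_band e in \<open>auto simp: \<omega>_def\<close>)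
      moreover have "n + e = n - 1 + d" using n e by simp
      ultimately show ?thesis by (simp add: c_def)
    qed
    moreover have "\<tau> (n - 1) = (- 1) ^ d * \<omega> (n - 1 + d) (n - 1) * \<tau> n"
      using \<tau>_step[of "n - 1"] n by simp
    \<comment> \<open>The sign (-1)^e and the minus in \<open>c e\<close> combine to the (-1)^d of
      \<open>\<tau>_step\<close>, so no sign remains in this formula.\<close>
    ultimately have "rows_det d (node_row M N r \<xi> (k n x) # map R [n..<n + d - 1]) = ?B (n - 1) * \<tau> (n - 1)"
      by (simp add: e)
    then show ?thesis using \<tau>_nz[of "n - 1"] by simp
  qed
  show ?thesis using \<tau>_nz first second by blast
qed

end
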